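(* Let $p\ge 11$ be a prime. Let $c$ be an integer such that $3c\equiv 1\pmod p$ (i.e., $c=1/3$ in $\mathbb{Z}_p$). Define subsets of $\mathbb{Z}_p$ by $$B=\{0,1,c\},\qquad A=\mathbb{Z}_p\setminus\{-1,-c,2c\}.$$ Then $|A|=p-3$, $|B|=3$, $|A|+|B|=p$, and $$|A\widehat{+}B|=p-2.$$ Moreover, neither $A$ nor $B$ is an arithmetic progression.
   Context: $\mathbb{Z}_p=\mathbb{Z}/p\mathbb{Z}$ is the cyclic group of order $p$; integers are identified with their residue classes modulo $p$. For nonempty $A,B\subset\mathbb{Z}_p$, the restricted sumset is $A\widehat{+}B=\{a+b: a\in A,\ b\in B,\ a\neq b\}$. A subset of $\mathbb{Z}_p$ of size $m$ is an arithmetic progression if it has the form $\{a_0+id: 0\le i\le m-1\}$ for some $a_0,d\in\mathbb{Z}_p$ with $d\neq 0$. *)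

theory Defs
  imports "HOL-Number_Theory.Number_Theory"
begin

text \<open>
  The group \<open>\<int>\<^sub>p\<close> is the additive group of the library's \<^const>\<open>residue_ring\<close>, whose carrier is
  the set of canonical representatives \<open>{0..p - 1}\<close>; the residue class of an integer \<open>n\<close> is
  therefore the element \<open>n mod p\<close>.
\<close>

abbreviation Zmod :: "nat \<Rightarrow> int ring"
  where "Zmod p \<equiv> residue_ring (int p)"

definition restricted_sumset :: "nat \<Rightarrow> int set \<Rightarrow> int set \<Rightarrow> int set"
  where "restricted_sumset p A B = {a \<oplus>\<^bsub>Zmod p\<^esub> b | a b. a \<in> A \<and> b \<in> B \<and> a \<noteq> b}"

text \<open>
  Here \<open>[i] \<cdot> d\<close> is the library's \<open>i\<close>-fold sum of \<open>d\<close>.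
\<close>

definition arith_progression :: "nat \<Rightarrow> int set \<Rightarrow> bool"
  where "arith_progression p S \<longleftrightarrow>
    (\<exists>a\<^sub>0 \<in> carrier (Zmod p). \<exists>d \<in> carrier (Zmod p). d \<noteq> \<zero>\<^bsub>Zmod p\<^esub> \<and>
       S = {a\<^sub>0 \<oplus>\<^bsub>Zmod p\<^esub> ([i] \<cdot>\<^bsub>Zmod p\<^esub> d) | i :: nat. i < card S})"

end

theory Submission
  imports Defs
begin

text \<open>
  Multiplying by \<open>3\<close> turns \<open>a + b c\<close> into the small integer \<open>3 a + b\<close>, so that
  \<open>B\<close> becomes \<open>{0, 3, 1}\<close> and the complement of \<open>A\<close> becomes \<open>{-3, -1, 2}\<close>. A residue \<open>x\<close> is
  missed by the restricted sumset iff \<open>x\<close> lies in \<open>{2 b} \<union> (b + {-1, -c, 2 c})\<close> for all three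
  \<open>b \<in> B\<close>, and after scaling these sets are \<open>{0, -3, -1, 2}\<close>, \<open>{6, 0, 2, 5}\<close> and \<open>{2, -2, 0, 3}\<close>,
  which share exactly \<open>0\<close> and \<open>2\<close>. The complement of a progression is a progression with the same
  difference, and neither \<open>{0, 3, 1}\<close> nor \<open>{-3, -1, 2}\<close> has an element that is the midpoint of the
  other two. All the required non-congruences are between integers at distance less than \<open>11\<close>.
\<close>

text \<open>Passes from the ring operations to integer arithmetic reduced once modulo
  \<open>p\<close>, so that a nonzero difference becomes one not divisible by
  \<open>p\<close>.\<close>

lemma arith_progressionE:
  assumes "arith_progression p S" and "p > 1"
  obtains a d :: int where "\<not> int p dvd d"
    and "S = (\<lambda>i. (a + int i * d) mod int p) ` {..<card S}"
proof -
  interpret residues "int p" "Zmod p"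
    using assms(2) by unfold_locales simp_all
  obtain a d where ad: "d \<in> carrier (Zmod p)" "d \<noteq> \<zero>\<^bsub>Zmod p\<^esub>"
    "S = {a \<oplus>\<^bsub>Zmod p\<^esub> ([i] \<cdot>\<^bsub>Zmod p\<^esub> d) | i :: nat. i < card S}"
    using assms(1) unfolding arith_progression_def by blast
  have mult: "[i] \<cdot>\<^bsub>Zmod p\<^esub> d = (int i * d) mod int p" for i :: nat
  proof (induction i)
    case 0
    then show ?case by (simp add: res_zero_eq)
  next
    case (Suc i)
    then show ?case
      using ad(1) by (simp add: add.nat_pow_Suc res_add_eq algebra_simps mod_simps)
  qed
  show thesis
  proof
    show "\<not> int p dvd d"
      using ad(1,2) zdvd_imp_le[of "int p" d] by (auto simp: res_carrier_eq res_zero_eq)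
    show "S = (\<lambda>i. (a + int i * d) mod int p) ` {..<card S}"
      by (subst ad(3)) (auto simp: mult res_add_eq mod_simps)
  qed
qed

text \<open>Primality makes \<open>d\<close> cancellable, and counting gives surjectivity. This
  serves to identify what a progression of \<open>p - 3\<close> terms omits: its next three
  terms.\<close>

lemma bij_betw_progression_mod_prime:
  fixes a d :: int
  assumes "prime p" and "\<not> int p dvd d"
  shows "bij_betw (\<lambda>i. (a + int i * d) mod int p) {..<p} {0..<int p}"
proof -
  let ?f = "\<lambda>i. (a + int i * d) mod int p"
  have inj: "inj_on ?f {..<p}"
  proof (rule inj_onI)
    fix i j assume ij: "i \<in> {..<p}" "j \<in> {..<p}" "?f i = ?f j"
    then have "int p dvd (int i - int j) * d"
      by (simp add: mod_eq_dvd_iff algebra_simps)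
    then have "int p dvd int i - int j"
      using assms by (simp add: prime_dvd_mult_iff)
    then have "int i mod int p = int j mod int p"
      by (simp add: mod_eq_dvd_iff)
    then show "i = j" using ij by simp
  qed
  have "?f ` {..<p} = {0..<int p}"
  proof (rule card_subset_eq)
    show "?f ` {..<p} \<subseteq> {0..<int p}"
      using prime_gt_0_nat[OF assms(1)] by auto
    show "card (?f ` {..<p}) = card {0..<int p}"
      using inj by (simp add: card_image)
  qed simp
  with inj show ?thesis by (simp add: bij_betw_def)
qed

text \<open>Whichever element is the middle term is half the sum of the other two. The offset
  \<open>k\<close> admits a block of terms taken from the end of a longer progression.\<close>

lemma three_term_progression_midpoint:
  fixes a d :: int
  assumes "{x mod m, y mod m, z mod m} = (\<lambda>i. (a + int i * d) mod m) ` {k..<k + 3}"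
    and "card {x mod m, y mod m, z mod m} = 3"
  shows "[x + y = 2 * z] (mod m) \<or> [y + z = 2 * x] (mod m) \<or> [z + x = 2 * y] (mod m)"
proof -
  define u where "u = (\<lambda>i. a + int i * d)"
  have "{k..<k + 3} = {k, k + 1, k + 2}" by auto
  then have eq: "{x mod m, y mod m, z mod m} = {u k mod m, u (k + 1) mod m, u (k + 2) mod m}"
    using assms(1) by (simp add: u_def)
  have mid: "[v + w = 2 * t] (mod m)"
    if "v mod m = u k mod m" "t mod m = u (k + 1) mod m" "w mod m = u (k + 2) mod m" for v t w
  proof -
    have "[v + w = u k + u (k + 2)] (mod m)"
      using that by (intro cong_add) (simp_all add: cong_def)
    also have "u k + u (k + 2) = 2 * u (k + 1)" by (simp add: u_def algebra_simps)
    also have "[2 * u (k + 1) = 2 * t] (mod m)"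
      using that by (intro cong_mult) (simp_all add: cong_def)
    finally show ?thesis .
  qed
  \<comment> \<open>Distinctness forces the matching of the two triples to be one of six
    permutations.\<close>
  have "x mod m \<noteq> y mod m" "y mod m \<noteq> z mod m" "x mod m \<noteq> z mod m"
    using assms(2) by (auto simp: card_insert_if split: if_splits)
  then consider
      "x mod m = u k mod m" "y mod m = u (k + 1) mod m" "z mod m = u (k + 2) mod m"
    | "x mod m = u k mod m" "z mod m = u (k + 1) mod m" "y mod m = u (k + 2) mod m"
    | "y mod m = u k mod m" "x mod m = u (k + 1) mod m" "z mod m = u (k + 2) mod m"
    | "y mod m = u k mod m" "z mod m = u (k + 1) mod m" "x mod m = u (k + 2) mod m"
    | "z mod m = u k mod m" "x mod m = u (k + 1) mod m" "y mod m = u (k + 2) mod m"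
    | "z mod m = u k mod m" "y mod m = u (k + 1) mod m" "x mod m = u (k + 2) mod m"
    using eq by (auto simp: set_eq_iff) metis+
  then show ?thesis
    by cases (use mid in \<open>metis add.commute\<close>)+
qed

text \<open>Since \<open>c\<close> inverts 3 modulo \<open>m\<close>, multiplication by 3 is
  injective, and it sends \<open>a + b * c\<close> to \<open>3 * a + b\<close>.\<close>

lemma cong_third_iff:
  fixes c m :: int
  assumes "[3 * c = 1] (mod m)"
  shows "[a + b * c = a' + b' * c] (mod m) \<longleftrightarrow> [3 * a + b = 3 * a' + b'] (mod m)"
proof -
  have scale: "[3 * (s + t * c) = 3 * s + t] (mod m)" for s t
    using cong_add[OF cong_refl[of "3 * s"] cong_mult[OF cong_refl[of t] assms]]
    by (simp add: algebra_simps)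
  have "coprime 3 m"
    using assms by (metis coprime_iff_invertible_int)
  then have "[a + b * c = a' + b' * c] (mod m) \<longleftrightarrow> [3 * (a + b * c) = 3 * (a' + b' * c)] (mod m)"
    by (simp only: cong_mult_lcancel)
  also have "\<dots> \<longleftrightarrow> [3 * a + b = 3 * a' + b'] (mod m)"
    using scale by (meson cong_sym cong_trans)
  finally show ?thesis .
qed

lemma cong_near_iff:
  fixes s t m :: int
  assumes "\<bar>s - t\<bar> < m"
  shows "[s = t] (mod m) \<longleftrightarrow> s = t"
  using assms zdvd_imp_le[of m "\<bar>s - t\<bar>"] by (auto simp: cong_iff_dvd_diff)

theorem theorem2p1:
  fixes p :: nat and c :: int and A B :: "int set"
  assumes "prime p" and "p \<ge> 11"
    and "[3 * c = 1] (mod int p)"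
    and "B = {0 mod int p, 1 mod int p, c mod int p}"
    and "A = carrier (Zmod p) - {(- 1) mod int p, (- c) mod int p, (2 * c) mod int p}"
  shows "card A = p - 3 \<and> card B = 3 \<and> card A + card B = p \<and>
    card (restricted_sumset p A B) = p - 2 \<and>
    \<not> arith_progression p A \<and> \<not> arith_progression p B"
proof -
  interpret residues "int p" "Zmod p"
    using assms(2) by unfold_locales simp_all
  let ?P = "int p"
  let ?C = "{(- 1) mod ?P, (- c) mod ?P, (2 * c) mod ?P}"
  have carrier: "carrier (Zmod p) = {0..<?P}"
    by (auto simp: res_carrier_eq)
  have sep: "(a + b * c) mod ?P = (a' + b' * c) mod ?P \<longleftrightarrow> 3 * a + b = 3 * a' + b'"
    if "\<bar>(3 * a + b) - (3 * a' + b')\<bar> < 11" for a b a' b'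
    using cong_third_iff[OF assms(3), of a b a' b']
      cong_near_iff[of "3 * a + b" "3 * a' + b'" ?P] that assms(2)
    by (simp add: cong_def)
  have cardB: "card B = 3"
    using sep[of 0 0 1 0] sep[of 0 0 0 1] sep[of 1 0 0 1] by (simp add: assms(4))
  have cardC: "card ?C = 3"
    using sep[of "-1" 0 0 "-1"] sep[of "-1" 0 0 2] sep[of 0 "-1" 0 2] by simp
  have C_sub: "?C \<subseteq> {0..<?P}"
    using assms(2) by simp
  have cardA: "card A = p - 3"
    using card_Diff_subset[OF _ C_sub] cardC by (simp add: assms(5) carrier)
  \<comment> \<open>With the bound 7, the distance to each of -3, -1, 2 is at most 10, as
    \<open>sep\<close> requires.\<close>
  have memA: "(a + b * c) mod ?P \<in> A"
    if "3 * a + b \<notin> {-3, -1, 2}" "\<bar>3 * a + b\<bar> \<le> 7" for a b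
    using sep[of a b "-1" 0] sep[of a b 0 "-1"] sep[of a b 0 2] that assms(2)
    by (auto simp: assms(5) carrier)

  have sumset: "x \<in> restricted_sumset p A B \<longleftrightarrow>
      (\<exists>a\<in>A. \<exists>b\<in>B. x = (a + b) mod ?P \<and> a \<noteq> b)" for x
    unfolding restricted_sumset_def by (auto simp: res_add_eq)
  have "restricted_sumset p A B = {0..<?P} - {0, (2 * c) mod ?P}"
  proof (intro equalityI subsetI)
    fix x assume "x \<in> restricted_sumset p A B"
    then obtain a b where ab: "a \<in> A" "b \<in> B" "x = (a + b) mod ?P" "a \<noteq> b"
      using sumset by blast
    have a: "a mod ?P = a" "a \<noteq> (-1) mod ?P" "a \<noteq> (-c) mod ?P" "a \<noteq> (2 * c) mod ?P"
      using ab(1) by (auto simp: assms(5) carrier)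
    have shift: "a = (t - s) mod ?P" if "b = s mod ?P" "(a + b) mod ?P = t mod ?P" for s t
    proof -
      have "(a + s) mod ?P = t mod ?P" using that by (simp add: mod_simps)
      then have "a mod ?P = (t - s) mod ?P" by (simp add: mod_eq_dvd_iff algebra_simps)
      then show ?thesis by (simp add: a)
    qed
    consider "b = 0 mod ?P" | "b = 1 mod ?P" | "b = c mod ?P"
      using ab(2) by (auto simp: assms(4))
    then have "(a + b) mod ?P \<noteq> 0 mod ?P \<and> (a + b) mod ?P \<noteq> (2 * c) mod ?P"
    \<comment> \<open>For \<open>b = 0\<close>, the sums 0 and \<open>2 * c\<close> would need
      \<open>a = b\<close> or \<open>a = 2 * c\<close>. For \<open>b = 1\<close> they would need
      \<open>a = -1\<close> or \<open>a = 2 * c - 1\<close>, and the latter is \<open>-c\<close>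
      because both scale to -1. For \<open>b = c\<close> they would need \<open>a = -c\<close> or
      \<open>a = b\<close>.\<close>
    proof cases
      case 1
      then show ?thesis using shift[OF 1, of 0] shift[OF 1, of "2 * c"] a ab(4) by auto
    next
      case 2
      then show ?thesis
        using shift[OF 2, of 0] shift[OF 2, of "2 * c"] a sep[of "-1" 2 0 "-1"] by auto
    next
      case 3
      then show ?thesis
        using shift[OF 3, of 0] shift[OF 3, of "2 * c"] a ab(4) by auto
    qed
    then show "x \<in> {0..<?P} - {0, (2 * c) mod ?P}"
      using ab(3) assms(2) by simp
  next
    fix x assume x: "x \<in> {0..<?P} - {0, (2 * c) mod ?P}"
    then have xmod: "x mod ?P = x" by simp
    consider "x \<in> A" | "x = (-1) mod ?P" | "x = (-c) mod ?P"
      using x by (auto simp: assms(5) carrier)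
    then show "x \<in> restricted_sumset p A B"
    \<comment> \<open>The representations are \<open>x + 0\<close>, \<open>-2 + 1\<close> and
      \<open>(-1 - c) + 1\<close>; the elements -2 and \<open>-1 - c\<close> scale to -6 and -4, so
      they lie in \<open>A\<close> and differ from 1, which scales to 3.\<close>
    proof cases
      case 1
      then show ?thesis
        using x xmod unfolding sumset
        by (intro bexI[of _ x] bexI[of _ 0]) (auto simp: assms(4))
    next
      case 2
      then show ?thesis
        using memA[of "-2" 0] sep[of "-2" 0 1 0] unfolding sumset
        by (intro bexI[of _ "(-2) mod ?P"] bexI[of _ "1 mod ?P"]) (auto simp: assms(4) mod_simps)
    next
      case 3
      then show ?thesis
        using memA[of "-1" "-1"] sep[of "-1" "-1" 1 0] unfolding sumset
        by (intro bexI[of _ "(-1 - c) mod ?P"] bexI[of _ "1 mod ?P"]) (auto simp: assms(4) mod_simps)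
    qed
  qed
  moreover have "card ({0..<?P} - {0, (2 * c) mod ?P}) = p - 2"
    using sep[of 0 0 0 2] assms(2) by (subst card_Diff_subset) auto
  ultimately have card_sumset: "card (restricted_sumset p A B) = p - 2" by simp

  have "\<not> arith_progression p B"
  proof
    assume "arith_progression p B"
    then obtain a d where "B = (\<lambda>i. (a + int i * d) mod ?P) ` {..<card B}"
      using arith_progressionE assms(2) by (metis m_gt_one of_nat_1 of_nat_less_iff)
    then have "{0 mod ?P, 1 mod ?P, c mod ?P} = (\<lambda>i. (a + int i * d) mod ?P) ` {0..<0 + 3}"
      unfolding cardB by (simp add: assms(4) lessThan_atLeast0)
    \<comment> \<open>After scaling, the three midpoint conditions read 3 = 2, 4 = 0 and 1 =
      6.\<close>
    from three_term_progression_midpoint[OF this] show False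
      using cardB sep[of 1 0 0 2] sep[of 1 1 0 0] sep[of 0 1 2 0]
      by (simp add: assms(4) cong_def)
  qed
  moreover have "\<not> arith_progression p A"
  proof
    assume "arith_progression p A"
    then obtain a d where d: "\<not> ?P dvd d"
      and A: "A = (\<lambda>i. (a + int i * d) mod ?P) ` {..<p - 3}"
      using arith_progressionE assms(2) cardA by (metis m_gt_one of_nat_1 of_nat_less_iff)
    let ?f = "\<lambda>i. (a + int i * d) mod ?P"
    have bij: "bij_betw ?f {..<p} {0..<?P}"
      by (rule bij_betw_progression_mod_prime[OF assms(1) d])
    \<comment> \<open>Continuing the progression to \<open>p\<close> terms covers the whole group,
      so its last three terms form the complement of \<open>A\<close>.\<close>
    have "{p - 3..<p - 3 + 3} = {..<p} - {..<p - 3}"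
      using assms(2) by auto
    then have "?f ` {p - 3..<p - 3 + 3} = ?f ` {..<p} - ?f ` {..<p - 3}"
      using bij_betw_imp_inj_on[OF bij]
      by (simp only:) (rule inj_on_image_set_diff, auto)
    also have "\<dots> = {0..<?P} - A"
      using bij A by (simp only: bij_betw_def)
    also have "\<dots> = ?C"
      using C_sub unfolding assms(5) carrier by blast
    finally have "?C = ?f ` {p - 3..<p - 3 + 3}" by (rule sym)
    \<comment> \<open>Here the scaled midpoint conditions read -4 = 4, 1 = -6 and -1 = -2.\<close>
    from three_term_progression_midpoint[OF this cardC] show False
      using sep[of "-1" "-1" 0 4] sep[of 0 1 "-2" 0] sep[of "-1" 2 0 "-2"]
      by (simp add: cong_def)
  qed
  ultimately show ?thesis
    using cardA cardB card_sumset assms(2) by simp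
qed

end
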